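(* Suppose that the $9$ coefficients $c_0,\dots,c_8$ of the monic polynomial $P_9(z)=z^9+\sum_{m=0}^{8}c_m z^m$ are expressed in terms of the $6$ parameters $\alpha_0,\alpha_1,\alpha_2,\beta_0,\beta_1,\beta_2$ by the $9$ formulas $$c_0=\alpha_0\left[\beta_1+\alpha_0(\alpha_0+\beta_2)\right]+\beta_0,$$ $$c_1=\alpha_0\alpha_1(3\alpha_0+2\beta_2)+\alpha_1\beta_1,$$ $$c_2=3\alpha_0\left[\alpha_1^2+\alpha_0\alpha_2\right]+\beta_2\left[\alpha_1^2+2\alpha_0\alpha_2\right]+\alpha_2\beta_1,$$ $$c_3=3\alpha_0(\alpha_0+2\alpha_1\alpha_2)+2\beta_2(\alpha_0+\alpha_1\alpha_2)+\alpha_1^3+\beta_1,$$ $$c_4=3\alpha_0\left[2\alpha_1+\alpha_2^2\right]+3\alpha_1^2\alpha_2+\left[2\alpha_1+\alpha_2^2\right]\beta_2,$$ $$c_5=3\alpha_1\left[\alpha_1+\alpha_2^2\right]+2\alpha_2(3\alpha_0+\beta_2),$$ $$c_6=3\alpha_0+\alpha_2\left[6\alpha_1+\alpha_2^2\right]+\beta_2,$$ $$c_7=3\left[\alpha_1+\alpha_2^2\right],$$ $$c_8=3\alpha_2.$$ Then: (i) The $6$ parameters satisfy $$\alpha_2=\frac{c_8}{3},\qquad \alpha_1=\frac{3c_7-c_8^2}{9},$$ $$\alpha_0=\frac{c_4-3\alpha_1^2\alpha_2}{3\left[2\alpha_1+\alpha_2^2\right]}-\frac{\beta_2}{3},$$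 $$\beta_2=\frac{c_3-3\alpha_0(\alpha_0+2\alpha_1\alpha_2)-\alpha_1^3-\beta_1}{2(\alpha_0+\alpha_1\alpha_2)},$$ $$\beta_1=\frac{c_1-\alpha_0\alpha_1(3\alpha_0+2\beta_2)}{\alpha_1},$$ $$\beta_0=c_0-\alpha_0\left[\alpha_0^2+\alpha_0\beta_2+\beta_1\right],$$ and these formulas, via their sequentially nested character, express explicitly the $6$ quantities $\alpha_0,\alpha_1,\alpha_2,\beta_0,\beta_1,\beta_2$ in terms of the $6$ coefficients $c_8,c_7,c_4,c_3,c_1,c_0$. (ii) The $9$ coefficients $c_m$ are required to satisfy $5$ constraints, namely the equality of the following $6$ expressions, in which $\alpha_2=c_8/3$ and $\alpha_1=(3c_7-c_8^2)/9$: $$c_6-\alpha_2\left[6\alpha_1+\alpha_2^2\right],\qquad \frac{c_5-3\alpha_1\left[\alpha_1+\alpha_2^2\right]}{2\alpha_2},\qquad \frac{c_4-3\alpha_1^2\alpha_2}{2\alpha_1+\alpha_2^2},$$ $$\frac{c_2\alpha_1-c_1\alpha_2}{\alpha_1^3},\qquad \frac{c_3\alpha_1-c_1-\alpha_1^4}{2\alpha_1^2\alpha_2},\qquad \frac{c_3\alpha_2-c_2-\alpha_1^3\alpha_2}{\alpha_1\left[2\alpha_2^2-\alpha_1\right]};$$ and these $5$ constraints can be expressed in the form of explicit expressions of any $5$ of the $6$ coefficients $c_\ell$ with $\ell=1,2,\dots,6$ in terms of the remaining coefficients $c_m$ with $m=1,2,\dots,8$.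
   Context: All parameters and coefficients are complex numbers. Formulas containing quotients are understood to be asserted where the denominators do not vanish.
   Formalization: In (i) the parameters are expressed only up to the translation R→R+t, Q(w)→Q(w−t), since the coefficients do not determine them; in (ii) the expression for each of the 5 chosen c_ℓ may involve all other c_m (1≤m≤8, m≠ℓ), other chosen ones included, as only 4 constraints are independent. *)

theory Defs
  imports Complex_Main "HOL-Computational_Algebra.Polynomial"
begin

(* The parameters alpha_0, alpha_1, alpha_2 and beta_0, beta_1, beta_2 are given by
   functions on nat, of which only the values at 0, 1, 2 are ever used; likewise only
   c 0, ..., c 8 are used of a coefficient function c. *)

definition coeff_formulas ::
  "(nat \<Rightarrow> complex) \<Rightarrow> (nat \<Rightarrow> complex) \<Rightarrow> (nat \<Rightarrow> complex) \<Rightarrow> bool" where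
  "coeff_formulas c \<alpha> \<beta> \<longleftrightarrow>
     c 0 = \<alpha> 0 * (\<beta> 1 + \<alpha> 0 * (\<alpha> 0 + \<beta> 2)) + \<beta> 0 \<and>
     c 1 = \<alpha> 0 * \<alpha> 1 * (3 * \<alpha> 0 + 2 * \<beta> 2) + \<alpha> 1 * \<beta> 1 \<and>
     c 2 = 3 * \<alpha> 0 * ((\<alpha> 1)^2 + \<alpha> 0 * \<alpha> 2) + \<beta> 2 * ((\<alpha> 1)^2 + 2 * \<alpha> 0 * \<alpha> 2) + \<alpha> 2 * \<beta> 1 \<and>
     c 3 = 3 * \<alpha> 0 * (\<alpha> 0 + 2 * \<alpha> 1 * \<alpha> 2) + 2 * \<beta> 2 * (\<alpha> 0 + \<alpha> 1 * \<alpha> 2) + (\<alpha> 1)^3 + \<beta> 1 \<and>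
     c 4 = 3 * \<alpha> 0 * (2 * \<alpha> 1 + (\<alpha> 2)^2) + 3 * (\<alpha> 1)^2 * \<alpha> 2 + (2 * \<alpha> 1 + (\<alpha> 2)^2) * \<beta> 2 \<and>
     c 5 = 3 * \<alpha> 1 * (\<alpha> 1 + (\<alpha> 2)^2) + 2 * \<alpha> 2 * (3 * \<alpha> 0 + \<beta> 2) \<and>
     c 6 = 3 * \<alpha> 0 + \<alpha> 2 * (6 * \<alpha> 1 + (\<alpha> 2)^2) + \<beta> 2 \<and>
     c 7 = 3 * (\<alpha> 1 + (\<alpha> 2)^2) \<and>
     c 8 = 3 * \<alpha> 2"

(* Each formula containing a quotient is asserted only where its denominator is nonzero. *)
definition inversion_formulas ::
  "(nat \<Rightarrow> complex) \<Rightarrow> (nat \<Rightarrow> complex) \<Rightarrow> (nat \<Rightarrow> complex) \<Rightarrow> bool" where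
  "inversion_formulas c \<alpha> \<beta> \<longleftrightarrow>
     \<alpha> 2 = c 8 / 3 \<and>
     \<alpha> 1 = (3 * c 7 - (c 8)^2) / 9 \<and>
     (3 * (2 * \<alpha> 1 + (\<alpha> 2)^2) \<noteq> 0 \<longrightarrow>
        \<alpha> 0 = (c 4 - 3 * (\<alpha> 1)^2 * \<alpha> 2) / (3 * (2 * \<alpha> 1 + (\<alpha> 2)^2)) - \<beta> 2 / 3) \<and>
     (2 * (\<alpha> 0 + \<alpha> 1 * \<alpha> 2) \<noteq> 0 \<longrightarrow>
        \<beta> 2 = (c 3 - 3 * \<alpha> 0 * (\<alpha> 0 + 2 * \<alpha> 1 * \<alpha> 2) - (\<alpha> 1)^3 - \<beta> 1) / (2 * (\<alpha> 0 + \<alpha> 1 * \<alpha> 2))) \<and>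
     (\<alpha> 1 \<noteq> 0 \<longrightarrow> \<beta> 1 = (c 1 - \<alpha> 0 * \<alpha> 1 * (3 * \<alpha> 0 + 2 * \<beta> 2)) / \<alpha> 1) \<and>
     \<beta> 0 = c 0 - \<alpha> 0 * ((\<alpha> 0)^2 + \<alpha> 0 * \<beta> 2 + \<beta> 1)"

definition inversion_denominators_nonzero :: "(nat \<Rightarrow> complex) \<Rightarrow> bool" where
  "inversion_denominators_nonzero \<alpha> \<longleftrightarrow>
     3 * (2 * \<alpha> 1 + (\<alpha> 2)^2) \<noteq> 0 \<and> 2 * (\<alpha> 0 + \<alpha> 1 * \<alpha> 2) \<noteq> 0 \<and> \<alpha> 1 \<noteq> 0"

(* The coefficient formulas say P_9 = Q(R(z)) with Q = w^3 + beta_2 w^2 + beta_1 w + beta_0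
   and R = z^3 + alpha_2 z^2 + alpha_1 z + alpha_0.  Replacing R by R + t and Q(w) by Q(w - t)
   leaves P_9 unchanged, so coefficients can determine the parameters only up to this
   translation. *)
definition equal_up_to_translation ::
  "(nat \<Rightarrow> complex) \<Rightarrow> (nat \<Rightarrow> complex) \<Rightarrow> (nat \<Rightarrow> complex) \<Rightarrow> (nat \<Rightarrow> complex) \<Rightarrow> bool" where
  "equal_up_to_translation \<alpha> \<beta> a b \<longleftrightarrow> (\<exists>t.
     [:\<alpha> 0, \<alpha> 1, \<alpha> 2, 1:] = [:a 0, a 1, a 2, 1:] + [:t:] \<and>
     [:\<beta> 0, \<beta> 1, \<beta> 2, 1:] = pcompose [:b 0, b 1, b 2, 1:] [:- t, 1:])"

(* Explicit expressions: formal rational expressions over the integers in symbols Coef m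
   standing for the coefficients c_m. *)
datatype rexp =
    Num int
  | Coef nat
  | Plus rexp rexp
  | Minus rexp rexp
  | Times rexp rexp
  | Quot rexp rexp

primrec rexp_val :: "(nat \<Rightarrow> complex) \<Rightarrow> rexp \<Rightarrow> complex" where
  "rexp_val c (Num k) = of_int k"
| "rexp_val c (Coef m) = c m"
| "rexp_val c (Plus e f) = rexp_val c e + rexp_val c f"
| "rexp_val c (Minus e f) = rexp_val c e - rexp_val c f"
| "rexp_val c (Times e f) = rexp_val c e * rexp_val c f"
| "rexp_val c (Quot e f) = rexp_val c e / rexp_val c f"

primrec rexp_defined :: "(nat \<Rightarrow> complex) \<Rightarrow> rexp \<Rightarrow> bool" where
  "rexp_defined c (Num k) \<longleftrightarrow> True"
| "rexp_defined c (Coef m) \<longleftrightarrow> True"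
| "rexp_defined c (Plus e f) \<longleftrightarrow> rexp_defined c e \<and> rexp_defined c f"
| "rexp_defined c (Minus e f) \<longleftrightarrow> rexp_defined c e \<and> rexp_defined c f"
| "rexp_defined c (Times e f) \<longleftrightarrow> rexp_defined c e \<and> rexp_defined c f"
| "rexp_defined c (Quot e f) \<longleftrightarrow> rexp_defined c e \<and> rexp_defined c f \<and> rexp_val c f \<noteq> 0"

primrec rexp_coeffs :: "rexp \<Rightarrow> nat set" where
  "rexp_coeffs (Num k) = {}"
| "rexp_coeffs (Coef m) = {m}"
| "rexp_coeffs (Plus e f) = rexp_coeffs e \<union> rexp_coeffs f"
| "rexp_coeffs (Minus e f) = rexp_coeffs e \<union> rexp_coeffs f"
| "rexp_coeffs (Times e f) = rexp_coeffs e \<union> rexp_coeffs f"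
| "rexp_coeffs (Quot e f) = rexp_coeffs e \<union> rexp_coeffs f"

(* The six expressions required to be equal, as (numerator, denominator) pairs. *)
definition constraint_fractions :: "(nat \<Rightarrow> complex) \<Rightarrow> (complex \<times> complex) list" where
  "constraint_fractions c =
     (let a2 = c 8 / 3; a1 = (3 * c 7 - (c 8)^2) / 9 in
      [(c 6 - a2 * (6 * a1 + a2^2), 1),
       (c 5 - 3 * a1 * (a1 + a2^2), 2 * a2),
       (c 4 - 3 * a1^2 * a2, 2 * a1 + a2^2),
       (c 2 * a1 - c 1 * a2, a1^3),
       (c 3 * a1 - c 1 - a1^4, 2 * a1^2 * a2),
       (c 3 * a2 - c 2 - a1^3 * a2, a1 * (2 * a2^2 - a1))])"

definition constraint_denominators_nonzero :: "(nat \<Rightarrow> complex) \<Rightarrow> bool" where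
  "constraint_denominators_nonzero c \<longleftrightarrow> (\<forall>(n, d) \<in> set (constraint_fractions c). d \<noteq> 0)"

definition constraints :: "(nat \<Rightarrow> complex) \<Rightarrow> bool" where
  "constraints c \<longleftrightarrow>
     (\<forall>(n, d) \<in> set (constraint_fractions c). \<forall>(n', d') \<in> set (constraint_fractions c).
        d \<noteq> 0 \<longrightarrow> d' \<noteq> 0 \<longrightarrow> n / d = n' / d')"

definition monic_of_degree_9 :: "complex poly \<Rightarrow> bool" where
  "monic_of_degree_9 P \<longleftrightarrow> degree P = 9 \<and> lead_coeff P = 1"

end

theory Submission
  imports Defs
begin

text \<open>
  The nine coefficient formulas say that the polynomial is a composite \<open>Q (R z)\<close> of two monic
  cubics, with \<open>R\<close> built from the \<open>\<alpha>\<close>s and \<open>Q\<close> from the \<open>\<beta>\<close>s.  The two top coefficients give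
  \<open>\<alpha> 2\<close> and \<open>\<alpha> 1\<close>.  After that, \<open>\<alpha> 0\<close> and \<open>\<beta> 2\<close> are visible in \<open>c 4\<close>, \<open>c 5\<close>, \<open>c 6\<close> only through
  the translation invariant \<open>S = 3 * \<alpha> 0 + \<beta> 2\<close>.  Eliminating \<open>\<beta> 1\<close> between two of \<open>c 1\<close>, \<open>c 2\<close>,
  \<open>c 3\<close> also leaves a multiple of \<open>S\<close>, so all six numerators are \<open>S\<close> times their denominators.
  This is necessity of the constraints.

  For the inversion, the nested formulas do not determine \<open>\<alpha> 0\<close>: once \<open>\<beta> 1\<close> is substituted into the
  formula for \<open>\<beta> 2\<close>, only \<open>S\<close> survives, and \<open>S\<close> is already fixed by \<open>c 4\<close>, so this formula turns
  into a condition on the coefficients alone.  What the formulas do say is that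
  \<open>Q w = G (w - \<alpha> 0)\<close> for a cubic \<open>G\<close> with coefficients explicit in \<open>c\<close> (lemma
  \<open>inversion_formulas_iff\<close>).  Hence any two solutions differ by a translation, and any admissible
  explicit value of \<open>\<alpha> 0\<close> gives an explicit solution.

  For the last part, each constraint, with \<open>S\<close> read off from \<open>c 6\<close>, is linear in any one of the
  coefficients that occur in it.  Of the three relations among \<open>c 1\<close>, \<open>c 2\<close>, \<open>c 3\<close> one follows
  from the other two, so the constraints amount to four equations (lemma
  \<open>constraints_iff_four_equations\<close>).  For every choice of five coefficients, each of the four
  equations can be solved for one of them, one equation serving for two coefficients.  The
  expression for one chosen coefficient may involve other chosen ones: for given \<open>c 7\<close> and \<open>c 8\<close>
  the solutions form a plane, so a single remaining coefficient could not determine the five others.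
\<close>

section \<open>Functions given by explicit expressions\<close>

text \<open>
  With this notion the required expressions can be written as ordinary functions of \<open>c\<close>; the
  condition \<open>D\<close> carries what is known about the denominators.
\<close>
definition explicit_in ::
  "nat set \<Rightarrow> ((nat \<Rightarrow> complex) \<Rightarrow> bool) \<Rightarrow> ((nat \<Rightarrow> complex) \<Rightarrow> complex) \<Rightarrow> bool" where
  "explicit_in V D f \<longleftrightarrow> (\<exists>e. rexp_coeffs e \<subseteq> V \<and>
     (\<forall>c. D c \<longrightarrow> rexp_defined c e \<and> rexp_val c e = f c))"

lemma explicit_coef: "m \<in> V \<Longrightarrow> explicit_in V D (\<lambda>c. c m)"
  unfolding explicit_in_def by (rule exI[of _ "Coef m"]) simp

lemma explicit_of_int: "explicit_in V D (\<lambda>c. of_int k)"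
  unfolding explicit_in_def by (rule exI[of _ "Num k"]) simp

lemma explicit_numeral: "explicit_in V D (\<lambda>c. numeral k)"
  using explicit_of_int[of V D "numeral k"] by simp

lemma explicit_one: "explicit_in V D (\<lambda>c. 1)"
  using explicit_of_int[of V D 1] by simp

lemma explicit_add:
  assumes "explicit_in V D f" "explicit_in V D g"
  shows "explicit_in V D (\<lambda>c. f c + g c)"
proof -
  from assms obtain e1 e2 where
    "rexp_coeffs e1 \<subseteq> V" "\<forall>c. D c \<longrightarrow> rexp_defined c e1 \<and> rexp_val c e1 = f c"
    "rexp_coeffs e2 \<subseteq> V" "\<forall>c. D c \<longrightarrow> rexp_defined c e2 \<and> rexp_val c e2 = g c"
    unfolding explicit_in_def by blast
  then show ?thesis unfolding explicit_in_def by (intro exI[of _ "Plus e1 e2"]) simp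
qed

lemma explicit_diff:
  assumes "explicit_in V D f" "explicit_in V D g"
  shows "explicit_in V D (\<lambda>c. f c - g c)"
proof -
  from assms obtain e1 e2 where
    "rexp_coeffs e1 \<subseteq> V" "\<forall>c. D c \<longrightarrow> rexp_defined c e1 \<and> rexp_val c e1 = f c"
    "rexp_coeffs e2 \<subseteq> V" "\<forall>c. D c \<longrightarrow> rexp_defined c e2 \<and> rexp_val c e2 = g c"
    unfolding explicit_in_def by blast
  then show ?thesis unfolding explicit_in_def by (intro exI[of _ "Minus e1 e2"]) simp
qed

lemma explicit_mult:
  assumes "explicit_in V D f" "explicit_in V D g"
  shows "explicit_in V D (\<lambda>c. f c * g c)"
proof -
  from assms obtain e1 e2 where
    "rexp_coeffs e1 \<subseteq> V" "\<forall>c. D c \<longrightarrow> rexp_defined c e1 \<and> rexp_val c e1 = f c"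
    "rexp_coeffs e2 \<subseteq> V" "\<forall>c. D c \<longrightarrow> rexp_defined c e2 \<and> rexp_val c e2 = g c"
    unfolding explicit_in_def by blast
  then show ?thesis unfolding explicit_in_def by (intro exI[of _ "Times e1 e2"]) simp
qed

lemma explicit_divide:
  assumes "explicit_in V D f" "explicit_in V D g" "\<And>c. D c \<Longrightarrow> g c \<noteq> 0"
  shows "explicit_in V D (\<lambda>c. f c / g c)"
proof -
  from assms(1,2) obtain e1 e2 where
    "rexp_coeffs e1 \<subseteq> V" "\<forall>c. D c \<longrightarrow> rexp_defined c e1 \<and> rexp_val c e1 = f c"
    "rexp_coeffs e2 \<subseteq> V" "\<forall>c. D c \<longrightarrow> rexp_defined c e2 \<and> rexp_val c e2 = g c"
    unfolding explicit_in_def by blast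
  with assms(3) show ?thesis unfolding explicit_in_def by (intro exI[of _ "Quot e1 e2"]) simp
qed

lemma explicit_power: "explicit_in V D f \<Longrightarrow> explicit_in V D (\<lambda>c. f c ^ n)"
  by (induction n) (simp_all add: explicit_one explicit_mult)

lemmas explicit_arith =
  explicit_numeral explicit_one explicit_add explicit_diff explicit_mult explicit_divide
  explicit_power explicit_coef

lemma explicit_family:
  assumes "\<And>i. i \<in> I \<Longrightarrow> explicit_in (V i) D (f i)"
  shows "\<exists>F. \<forall>i\<in>I. rexp_coeffs (F i) \<subseteq> V i \<and>
           (\<forall>c. D c \<longrightarrow> rexp_defined c (F i) \<and> rexp_val c (F i) = f i c)"
  using assms unfolding explicit_in_def by (intro bchoice) blast

section \<open>Necessity of the constraints\<close>

definition inner2 :: "(nat \<Rightarrow> complex) \<Rightarrow> complex" where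
  "inner2 c = c 8 / 3"

definition inner1 :: "(nat \<Rightarrow> complex) \<Rightarrow> complex" where
  "inner1 c = (3 * c 7 - (c 8)^2) / 9"

lemma explicit_inner2: "8 \<in> V \<Longrightarrow> explicit_in V D inner2"
  unfolding inner2_def[abs_def] by (intro explicit_arith) simp_all

lemma explicit_inner1: "7 \<in> V \<Longrightarrow> 8 \<in> V \<Longrightarrow> explicit_in V D inner1"
  unfolding inner1_def[abs_def] by (intro explicit_arith) simp_all

lemmas constraint_fractions_inner =
  constraint_fractions_def[folded inner1_def inner2_def, unfolded Let_def]

lemma constraintsI:
  assumes "\<And>n d. (n, d) \<in> set (constraint_fractions c) \<Longrightarrow> n = S * d"
  shows "constraints c"
proof -
  have "n / d = S" if "(n, d) \<in> set (constraint_fractions c)" "d \<noteq> 0" for n d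
    using assms[OF that(1)] that(2) by simp
  then show ?thesis unfolding constraints_def by clarify simp
qed

lemma coeff_formulas_inner:
  assumes "coeff_formulas c \<alpha> \<beta>"
  shows "inner2 c = \<alpha> 2" "inner1 c = \<alpha> 1"
  using assms unfolding coeff_formulas_def inner1_def inner2_def
  by (simp_all add: power2_eq_square algebra_simps)

lemma coeff_formulas_imp_constraints:
  assumes "coeff_formulas c \<alpha> \<beta>"
  shows "constraints c"
proof (rule constraintsI)
  fix n d
  assume "(n, d) \<in> set (constraint_fractions c)"
  with assms show "n = (3 * \<alpha> 0 + \<beta> 2) * d"
    unfolding constraint_fractions_inner coeff_formulas_inner[OF assms] coeff_formulas_def
    by (elim conjE) (auto, (simp add: power2_eq_square power3_eq_cube power4_eq_xxxx algebra_simps)+)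
qed

lemma coeff_formulas_imp_inversion_formulas:
  assumes "coeff_formulas c \<alpha> \<beta>"
  shows "inversion_formulas c \<alpha> \<beta>"
proof -
  have c: "c 0 = \<alpha> 0 * (\<beta> 1 + \<alpha> 0 * (\<alpha> 0 + \<beta> 2)) + \<beta> 0"
    "c 1 = \<alpha> 0 * \<alpha> 1 * (3 * \<alpha> 0 + 2 * \<beta> 2) + \<alpha> 1 * \<beta> 1"
    "c 3 = 3 * \<alpha> 0 * (\<alpha> 0 + 2 * \<alpha> 1 * \<alpha> 2) + 2 * \<beta> 2 * (\<alpha> 0 + \<alpha> 1 * \<alpha> 2) + (\<alpha> 1)^3 + \<beta> 1"
    "c 4 = 3 * \<alpha> 0 * (2 * \<alpha> 1 + (\<alpha> 2)^2) + 3 * (\<alpha> 1)^2 * \<alpha> 2 + (2 * \<alpha> 1 + (\<alpha> 2)^2) * \<beta> 2"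
    using assms unfolding coeff_formulas_def by simp_all
  have "\<alpha> 0 = (c 4 - 3 * (\<alpha> 1)^2 * \<alpha> 2) / (3 * (2 * \<alpha> 1 + (\<alpha> 2)^2)) - \<beta> 2 / 3"
    if nz: "3 * (2 * \<alpha> 1 + (\<alpha> 2)^2) \<noteq> 0"
  proof -
    have "c 4 - 3 * (\<alpha> 1)^2 * \<alpha> 2 = (\<alpha> 0 + \<beta> 2 / 3) * (3 * (2 * \<alpha> 1 + (\<alpha> 2)^2))"
      unfolding c by (simp add: algebra_simps)
    then show ?thesis using nz by (metis add_diff_cancel_right' nonzero_mult_div_cancel_right)
  qed
  moreover have "\<beta> 2 = (c 3 - 3 * \<alpha> 0 * (\<alpha> 0 + 2 * \<alpha> 1 * \<alpha> 2) - (\<alpha> 1)^3 - \<beta> 1)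
      / (2 * (\<alpha> 0 + \<alpha> 1 * \<alpha> 2))"
    if nz: "2 * (\<alpha> 0 + \<alpha> 1 * \<alpha> 2) \<noteq> 0"
  proof -
    have "c 3 - 3 * \<alpha> 0 * (\<alpha> 0 + 2 * \<alpha> 1 * \<alpha> 2) - (\<alpha> 1)^3 - \<beta> 1 = \<beta> 2 * (2 * (\<alpha> 0 + \<alpha> 1 * \<alpha> 2))"
      unfolding c by (simp add: algebra_simps)
    then show ?thesis using nz by (metis nonzero_mult_div_cancel_right)
  qed
  moreover have "\<beta> 1 = (c 1 - \<alpha> 0 * \<alpha> 1 * (3 * \<alpha> 0 + 2 * \<beta> 2)) / \<alpha> 1" if "\<alpha> 1 \<noteq> 0"
    using that unfolding c by simp
  moreover have "\<beta> 0 = c 0 - \<alpha> 0 * ((\<alpha> 0)^2 + \<alpha> 0 * \<beta> 2 + \<beta> 1)"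
    unfolding c by (simp add: power2_eq_square algebra_simps)
  ultimately show ?thesis
    using coeff_formulas_inner[OF assms] unfolding inversion_formulas_def inner1_def inner2_def
    by simp
qed

section \<open>Inversion up to translation\<close>

definition base2 :: "(nat \<Rightarrow> complex) \<Rightarrow> complex" where
  "base2 c = (c 4 - 3 * (inner1 c)^2 * inner2 c) / (2 * inner1 c + (inner2 c)^2)"

definition base1 :: "(nat \<Rightarrow> complex) \<Rightarrow> complex" where
  "base1 c = c 1 / inner1 c"

text \<open>
  The cubic \<open>G\<close> of the introduction is \<open>w^3 + base2 c * w^2 + base1 c * w + c 0\<close>; it is the \<open>Q\<close>
  belonging to \<open>\<alpha> 0 = 0\<close>.
\<close>
definition base_cubic :: "(nat \<Rightarrow> complex) \<Rightarrow> complex poly" where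
  "base_cubic c = [:c 0, base1 c, base2 c, 1:]"

lemma base_cubic_shift:
  "pcompose (base_cubic c) [:- x, 1:] =
     [:c 0 - base1 c * x + base2 c * x^2 - x^3, base1 c - 2 * base2 c * x + 3 * x^2,
       base2 c - 3 * x, 1:]"
  unfolding base_cubic_def
  by (simp add: pcompose_pCons power2_eq_square power3_eq_cube algebra_simps)

text \<open>
  Substituting the expression for \<open>\<beta> 1\<close> into the formula for \<open>\<beta> 2\<close> cancels the terms quadratic in
  \<open>\<alpha> 0\<close> as well as \<open>\<alpha> 0 * \<beta> 2\<close>, and what remains involves only the invariant \<open>3 * \<alpha> 0 + \<beta> 2\<close>.
  Thus the formula for \<open>\<beta> 2\<close> becomes a compatibility condition on the coefficients, and \<open>\<alpha> 0\<close> is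
  left as a free parameter.
\<close>
lemma inversion_formulas_iff:
  assumes "inversion_denominators_nonzero \<alpha>"
  shows "inversion_formulas c \<alpha> \<beta> \<longleftrightarrow>
    \<alpha> 2 = inner2 c \<and> \<alpha> 1 = inner1 c \<and>
    2 * inner1 c * inner2 c * base2 c = c 3 - (inner1 c)^3 - base1 c \<and>
    [:\<beta> 0, \<beta> 1, \<beta> 2, 1:] = pcompose (base_cubic c) [:- \<alpha> 0, 1:]"
proof (cases "\<alpha> 2 = inner2 c \<and> \<alpha> 1 = inner1 c")
  case False
  then show ?thesis unfolding inversion_formulas_def inner1_def inner2_def by auto
next
  case True
  define p q x where "p = inner1 c" and "q = inner2 c" and "x = \<alpha> 0"
  define K k where "K = base2 c" and "k = base1 c"
  have nz: "p \<noteq> 0" "2 * p + q^2 \<noteq> 0" "x + p * q \<noteq> 0"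
    using assms True unfolding inversion_denominators_nonzero_def p_def q_def x_def
    by (simp_all del: distrib_left_numeral)
  have K: "(c 4 - 3 * p^2 * q) / (3 * (2 * p + q^2)) = K / 3"
    unfolding K_def base2_def p_def q_def by simp
  have c1: "c 1 = k * p"
    using nz(1) unfolding k_def base1_def p_def by simp
  have e2: "x = (c 4 - 3 * p^2 * q) / (3 * (2 * p + q^2)) - \<beta> 2 / 3 \<longleftrightarrow> \<beta> 2 = K - 3 * x"
    unfolding K by (auto simp: field_simps)
  have e1: "\<beta> 1 = (c 1 - x * p * (3 * x + 2 * \<beta> 2)) / p \<longleftrightarrow> \<beta> 1 = k - x * (3 * x + 2 * \<beta> 2)"
    unfolding c1 using nz(1) by (simp add: diff_divide_distrib)
  have e3: "\<beta> 2 = (c 3 - 3 * x * (x + 2 * p * q) - p^3 - \<beta> 1) / (2 * (x + p * q)) \<longleftrightarrow>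
      \<beta> 2 * (2 * (x + p * q)) = c 3 - 3 * x * (x + 2 * p * q) - p^3 - \<beta> 1"
    using nz(3) by (subst nonzero_eq_divide_eq) (simp_all del: distrib_left_numeral)
  have inv: "inversion_formulas c \<alpha> \<beta> \<longleftrightarrow>
      \<beta> 2 = K - 3 * x \<and>
      \<beta> 2 * (2 * (x + p * q)) = c 3 - 3 * x * (x + 2 * p * q) - p^3 - \<beta> 1 \<and>
      \<beta> 1 = k - x * (3 * x + 2 * \<beta> 2) \<and>
      \<beta> 0 = c 0 - x * (x^2 + x * \<beta> 2 + \<beta> 1)"
    using True nz e1 e2 e3 unfolding inversion_formulas_def p_def q_def x_def
    by (simp add: inner1_def[symmetric] inner2_def[symmetric] del: distrib_left_numeral)
  have b1: "k - x * (3 * x + 2 * (K - 3 * x)) = k - 2 * K * x + 3 * x^2"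
    by (simp add: power2_eq_square algebra_simps)
  have b0: "c 0 - x * (x^2 + x * (K - 3 * x) + (k - 2 * K * x + 3 * x^2))
      = c 0 - k * x + K * x^2 - x^3"
    by (simp add: power2_eq_square power3_eq_cube algebra_simps)
  have compat: "(K - 3 * x) * (2 * (x + p * q))
        = c 3 - 3 * x * (x + 2 * p * q) - p^3 - (k - 2 * K * x + 3 * x^2)
      \<longleftrightarrow> 2 * p * q * K = c 3 - p^3 - k"
    by (auto simp: power2_eq_square algebra_simps)
  have "inversion_formulas c \<alpha> \<beta> \<longleftrightarrow> 2 * p * q * K = c 3 - p^3 - k \<and>
      \<beta> 2 = K - 3 * x \<and> \<beta> 1 = k - 2 * K * x + 3 * x^2 \<and> \<beta> 0 = c 0 - k * x + K * x^2 - x^3"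
    unfolding inv by (metis b1 b0 compat)
  then show ?thesis
    using True unfolding base_cubic_shift p_def q_def x_def K_def k_def by auto
qed

text \<open>
  The representative of the translation class.  Taking \<open>\<alpha> 0 = 0\<close> could make the denominator
  \<open>2 * (\<alpha> 0 + \<alpha> 1 * \<alpha> 2)\<close> vanish; the value chosen here makes it equal to \<open>2\<close>.
\<close>
definition rep_alpha :: "nat \<Rightarrow> (nat \<Rightarrow> complex) \<Rightarrow> complex" where
  "rep_alpha i c =
     (if i = 0 then 1 - inner1 c * inner2 c else if i = 1 then inner1 c else inner2 c)"

definition rep_beta :: "nat \<Rightarrow> (nat \<Rightarrow> complex) \<Rightarrow> complex" where
  "rep_beta i c = coeff (pcompose (base_cubic c) [:- rep_alpha 0 c, 1:]) i"

lemma rep_beta_poly: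
  "[:rep_beta 0 c, rep_beta 1 c, rep_beta 2 c, 1:] = pcompose (base_cubic c) [:- rep_alpha 0 c, 1:]"
  unfolding rep_beta_def base_cubic_shift by (simp add: numeral_2_eq_2)

lemma rep_solves_inversion:
  assumes "inversion_denominators_nonzero \<alpha>" "inversion_formulas c \<alpha> \<beta>"
  shows "inversion_denominators_nonzero (\<lambda>i. rep_alpha i c)"
    and "inversion_formulas c (\<lambda>i. rep_alpha i c) (\<lambda>i. rep_beta i c)"
    and "equal_up_to_translation \<alpha> \<beta> (\<lambda>i. rep_alpha i c) (\<lambda>i. rep_beta i c)"
proof -
  note sol = assms(2)[unfolded inversion_formulas_iff[OF assms(1)]]
  show nz: "inversion_denominators_nonzero (\<lambda>i. rep_alpha i c)"
    using sol assms(1) unfolding inversion_denominators_nonzero_def by (simp add: rep_alpha_def)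
  show "inversion_formulas c (\<lambda>i. rep_alpha i c) (\<lambda>i. rep_beta i c)"
    using sol unfolding inversion_formulas_iff[OF nz] rep_beta_poly by (simp add: rep_alpha_def)
  define t where "t = \<alpha> 0 - rep_alpha 0 c"
  have "[:- \<alpha> 0, 1:] = pcompose [:- rep_alpha 0 c, 1:] [:- t, 1:]"
    by (simp add: t_def pcompose_pCons)
  then have "[:\<beta> 0, \<beta> 1, \<beta> 2, 1:] =
      pcompose [:rep_beta 0 c, rep_beta 1 c, rep_beta 2 c, 1:] [:- t, 1:]"
    using sol unfolding rep_beta_poly by (simp add: pcompose_assoc)
  moreover have "[:\<alpha> 0, \<alpha> 1, \<alpha> 2, 1:] =
      [:rep_alpha 0 c, rep_alpha 1 c, rep_alpha 2 c, 1:] + [:t:]"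
    using sol by (simp add: t_def rep_alpha_def)
  ultimately show "equal_up_to_translation \<alpha> \<beta> (\<lambda>i. rep_alpha i c) (\<lambda>i. rep_beta i c)"
    unfolding equal_up_to_translation_def by blast
qed

definition inner_denominators_nonzero :: "(nat \<Rightarrow> complex) \<Rightarrow> bool" where
  "inner_denominators_nonzero c \<longleftrightarrow> inner1 c \<noteq> 0 \<and> 2 * inner1 c + (inner2 c)^2 \<noteq> 0"

lemma inner_denominators_nonzero:
  assumes "inversion_denominators_nonzero \<alpha>" "inversion_formulas c \<alpha> \<beta>"
  shows "inner_denominators_nonzero c"
proof -
  have "\<alpha> 2 = inner2 c" "\<alpha> 1 = inner1 c"
    using assms(2) unfolding inversion_formulas_def inner1_def inner2_def by simp_all
  with assms(1) show ?thesis
    unfolding inversion_denominators_nonzero_def inner_denominators_nonzero_def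
    by (simp del: distrib_left_numeral)
qed

lemma explicit_rep_alpha:
  assumes "7 \<in> V" "8 \<in> V"
  shows "explicit_in V D (rep_alpha i)"
proof -
  note rules = explicit_arith explicit_inner1[OF assms] explicit_inner2[OF assms(2)]
  have "explicit_in V D (\<lambda>c. 1 - inner1 c * inner2 c)"
    by (intro rules)
  then show ?thesis
    unfolding rep_alpha_def[abs_def]
    by (cases "i = 0"; cases "i = 1") (simp_all add: rules)
qed

lemma explicit_rep_beta:
  assumes "i \<in> {0, 1, 2}" "{0, 1, 3, 4, 7, 8} \<subseteq> V"
  shows "explicit_in V inner_denominators_nonzero (rep_beta i)"
proof -
  have V: "0 \<in> V" "1 \<in> V" "4 \<in> V" "7 \<in> V" "8 \<in> V" using assms(2) by auto
  note inner = explicit_inner1[OF V(4,5)] explicit_inner2[OF V(5)]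
  have base2: "explicit_in V inner_denominators_nonzero base2"
    unfolding base2_def[abs_def]
    by (intro explicit_arith inner V) (simp_all add: inner_denominators_nonzero_def)
  have base1: "explicit_in V inner_denominators_nonzero base1"
    unfolding base1_def[abs_def]
    by (intro explicit_arith inner V) (simp_all add: inner_denominators_nonzero_def)
  note rules = explicit_arith base1 base2 explicit_rep_alpha[OF V(4,5)] V
  let ?x = "rep_alpha 0"
  have "explicit_in V inner_denominators_nonzero
      (\<lambda>c. c 0 - base1 c * ?x c + base2 c * ?x c ^ 2 - ?x c ^ 3)"
    by (intro rules)
  moreover have "explicit_in V inner_denominators_nonzero
      (\<lambda>c. base1 c - 2 * base2 c * ?x c + 3 * ?x c ^ 2)"
    by (intro rules)
  moreover have "explicit_in V inner_denominators_nonzero (\<lambda>c. base2 c - 3 * ?x c)"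
    by (intro rules)
  ultimately show ?thesis
    using assms(1) unfolding rep_beta_def[abs_def] base_cubic_shift by (auto simp: numeral_2_eq_2)
qed

lemma explicit_inversion:
  "\<exists>A B :: nat \<Rightarrow> rexp.
    (\<forall>i\<in>{0,1,2}. rexp_coeffs (A i) \<subseteq> {8,7,4,3,1,0} \<and> rexp_coeffs (B i) \<subseteq> {8,7,4,3,1,0}) \<and>
    (\<forall>c \<alpha> \<beta>. inversion_denominators_nonzero \<alpha> \<and> inversion_formulas c \<alpha> \<beta> \<longrightarrow>
      (let a = (\<lambda>i. rexp_val c (A i)); b = (\<lambda>i. rexp_val c (B i)) in
        (\<forall>i\<in>{0,1,2}. rexp_defined c (A i) \<and> rexp_defined c (B i)) \<and>
        inversion_denominators_nonzero a \<and> inversion_formulas c a b \<and>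
        equal_up_to_translation \<alpha> \<beta> a b))"
proof -
  let ?V = "{8,7,4,3,1,0} :: nat set"
  let ?D = inner_denominators_nonzero
  have "explicit_in ?V ?D (rep_alpha i)" for i
    by (rule explicit_rep_alpha) simp_all
  from explicit_family[OF this] obtain A where A: "\<forall>i\<in>{0,1,2}. rexp_coeffs (A i) \<subseteq> ?V \<and>
      (\<forall>c. ?D c \<longrightarrow> rexp_defined c (A i) \<and> rexp_val c (A i) = rep_alpha i c)" ..
  have "explicit_in ?V ?D (rep_beta i)" if "i \<in> {0,1,2}" for i
    using that by (rule explicit_rep_beta) simp
  from explicit_family[OF this] obtain B where B: "\<forall>i\<in>{0,1,2}. rexp_coeffs (B i) \<subseteq> ?V \<and>
      (\<forall>c. ?D c \<longrightarrow> rexp_defined c (B i) \<and> rexp_val c (B i) = rep_beta i c)" ..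
  show ?thesis
  proof (rule exI[of _ A], rule exI[of _ B], intro conjI allI impI)
    show "\<forall>i\<in>{0,1,2}. rexp_coeffs (A i) \<subseteq> ?V \<and> rexp_coeffs (B i) \<subseteq> ?V"
      using bspec[OF A] bspec[OF B] by simp
  next
    fix c \<alpha> \<beta>
    assume hyp: "inversion_denominators_nonzero \<alpha> \<and> inversion_formulas c \<alpha> \<beta>"
    then have D: "inner_denominators_nonzero c" using inner_denominators_nonzero by blast
    have val: "rexp_val c (A i) = rep_alpha i c" "rexp_val c (B i) = rep_beta i c" if "i \<in> {0,1,2}" for i
      using A[rule_format, OF that] B[rule_format, OF that] D by simp_all
    have "rexp_val c (A 0) = rep_alpha 0 c" "rexp_val c (B 0) = rep_beta 0 c"
      "rexp_val c (A 1) = rep_alpha 1 c" "rexp_val c (B 1) = rep_beta 1 c"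
      "rexp_val c (A 2) = rep_alpha 2 c" "rexp_val c (B 2) = rep_beta 2 c"
      using val by simp_all
    note vals = this
    have "inversion_denominators_nonzero (\<lambda>i. rexp_val c (A i))"
      "inversion_formulas c (\<lambda>i. rexp_val c (A i)) (\<lambda>i. rexp_val c (B i))"
      "equal_up_to_translation \<alpha> \<beta> (\<lambda>i. rexp_val c (A i)) (\<lambda>i. rexp_val c (B i))"
      using rep_solves_inversion[OF conjunct1[OF hyp] conjunct2[OF hyp]]
      unfolding inversion_denominators_nonzero_def inversion_formulas_def
        equal_up_to_translation_def vals by -
    moreover have "\<forall>i\<in>{0,1,2}. rexp_defined c (A i) \<and> rexp_defined c (B i)"
      using bspec[OF A] bspec[OF B] D by simp
    ultimately show "let a = (\<lambda>i. rexp_val c (A i)); b = (\<lambda>i. rexp_val c (B i)) in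
        (\<forall>i\<in>{0,1,2}. rexp_defined c (A i) \<and> rexp_defined c (B i)) \<and>
        inversion_denominators_nonzero a \<and> inversion_formulas c a b \<and>
        equal_up_to_translation \<alpha> \<beta> a b"
      unfolding Let_def by (intro conjI)
  qed
qed

section \<open>Solving the constraints for five coefficients\<close>

text \<open>The translation invariant \<open>3 * \<alpha> 0 + \<beta> 2\<close>, read off from \<open>c 6\<close>.\<close>
definition invariant :: "(nat \<Rightarrow> complex) \<Rightarrow> complex" where
  "invariant c = c 6 - inner2 c * (6 * inner1 c + (inner2 c)^2)"

text \<open>
  The condition on the sixth fraction follows from those on the fourth and fifth: \<open>inner1 c\<close> times its numerator is \<open>inner2 c\<close> times
  the fifth numerator minus the fourth one, and the denominators are related in the same way.
\<close>
lemma constraints_iff_four_equations: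
  assumes "constraint_denominators_nonzero c"
  defines "p \<equiv> inner1 c" and "q \<equiv> inner2 c" and "S \<equiv> invariant c"
  shows "constraints c \<longleftrightarrow>
    c 5 - 3 * p * (p + q^2) = S * (2 * q) \<and>
    c 4 - 3 * p^2 * q = S * (2 * p + q^2) \<and>
    c 2 * p - c 1 * q = S * p^3 \<and>
    c 3 * p - c 1 - p^4 = S * (2 * p^2 * q)"
    (is "_ \<longleftrightarrow> ?eqs")
proof
  assume con: "constraints c"
  have "n = S * d" if "(n, d) \<in> set (constraint_fractions c)" for n d
  proof -
    have "d \<noteq> 0"
      using assms(1) that unfolding constraint_denominators_nonzero_def by blast
    moreover have "(S, 1) \<in> set (constraint_fractions c)"
      unfolding constraint_fractions_inner S_def invariant_def by simp
    ultimately have "n / d = S / 1"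
      using con that unfolding constraints_def by fastforce
    with \<open>d \<noteq> 0\<close> show ?thesis by (simp add: divide_eq_eq)
  qed
  then show ?eqs
    unfolding constraint_fractions_inner p_def q_def by simp
next
  assume eqs: ?eqs
  have "p \<noteq> 0"
    using assms(1) unfolding constraint_denominators_nonzero_def constraint_fractions_inner p_def
    by simp
  have "p * (c 3 * q - c 2 - p^3 * q) = q * (c 3 * p - c 1 - p^4) - (c 2 * p - c 1 * q)"
    by (simp add: power4_eq_xxxx power3_eq_cube algebra_simps)
  also have "\<dots> = p * (S * (p * (2 * q^2 - p)))"
    using eqs by (simp add: power2_eq_square power3_eq_cube algebra_simps)
  finally have sixth: "c 3 * q - c 2 - p^3 * q = S * (p * (2 * q^2 - p))"
    using \<open>p \<noteq> 0\<close> by simp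
  show "constraints c"
  proof (rule constraintsI[of _ S])
    fix n d
    assume "(n, d) \<in> set (constraint_fractions c)"
    with eqs sixth show "n = S * d"
      unfolding constraint_fractions_inner p_def q_def S_def invariant_def by auto
  qed
qed

text \<open>
  Each equation has to be solved for some coefficient with index in \<open>L\<close>.  When \<open>2\<close> is left out,
  the equation containing \<open>c 2\<close> is solved for \<open>c 1\<close>; when \<open>4\<close> is left out, the one containing \<open>c 4\<close>
  is solved for \<open>c 6\<close>.  In the other cases the choice for \<open>c 1\<close> keeps the equation containing
  \<open>c 3\<close>, and the choice for \<open>c 6\<close> the one containing \<open>c 5\<close>, in case \<open>3\<close> or \<open>5\<close> is left out.
\<close>
definition solved :: "nat set \<Rightarrow> nat \<Rightarrow> (nat \<Rightarrow> complex) \<Rightarrow> complex" where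
  "solved L l c = (let p = inner1 c; q = inner2 c; S = invariant c in
     if l = 1 then
       (if 2 \<in> L then c 3 * p - p^4 - S * (2 * p^2 * q) else (c 2 * p - S * p^3) / q)
     else if l = 2 then (c 1 * q + S * p^3) / p
     else if l = 3 then (c 1 + p^4 + S * (2 * p^2 * q)) / p
     else if l = 4 then 3 * p^2 * q + S * (2 * p + q^2)
     else if l = 5 then 3 * p * (p + q^2) + S * (2 * q)
     else q * (6 * p + q^2) +
       (if 4 \<in> L then (c 5 - 3 * p * (p + q^2)) / (2 * q)
        else (c 4 - 3 * p^2 * q) / (2 * p + q^2)))"

lemma constraint_denominators_inner:
  assumes "constraint_denominators_nonzero c"
  shows "inner1 c \<noteq> 0" "inner2 c \<noteq> 0" "2 * inner1 c + (inner2 c)^2 \<noteq> 0"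
  using assms unfolding constraint_denominators_nonzero_def constraint_fractions_inner by simp_all

lemma explicit_solved:
  assumes "l \<in> {1..6}"
  shows "explicit_in ({1..8} - {l}) constraint_denominators_nonzero (solved L l)"
proof -
  let ?V = "{1..8} - {l} :: nat set"
  let ?D = constraint_denominators_nonzero
  have inner: "explicit_in ?V ?D inner1" "explicit_in ?V ?D inner2"
    using assms by (auto intro!: explicit_inner1 explicit_inner2)
  have invariant: "explicit_in ?V ?D invariant" if "l \<noteq> 6"
    unfolding invariant_def[abs_def] using that by (intro explicit_arith inner) auto
  note rules = explicit_arith inner
  note nz = constraint_denominators_inner
  consider "l = 1" | "l = 2" | "l = 3" | "l = 4" | "l = 5" | "l = 6" using assms by fastforce
  then show ?thesis
  proof cases
    case 1
    show ?thesis
    proof (cases "2 \<in> L")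
      case True
      have "explicit_in ?V ?D (\<lambda>c. c 3 * inner1 c - inner1 c ^ 4
          - invariant c * (2 * inner1 c ^ 2 * inner2 c))"
        using 1 by (intro rules invariant) auto
      with True 1 show ?thesis unfolding solved_def[abs_def] Let_def by simp
    next
      case False
      have "explicit_in ?V ?D (\<lambda>c. (c 2 * inner1 c - invariant c * inner1 c ^ 3) / inner2 c)"
        using 1 nz by (intro rules invariant) auto
      with False 1 show ?thesis unfolding solved_def[abs_def] Let_def by simp
    qed
  next
    case 2
    have "explicit_in ?V ?D (\<lambda>c. (c 1 * inner2 c + invariant c * inner1 c ^ 3) / inner1 c)"
      using 2 nz by (intro rules invariant) auto
    with 2 show ?thesis unfolding solved_def[abs_def] Let_def by simp
  next
    case 3
    have "explicit_in ?V ?D (\<lambda>c. (c 1 + inner1 c ^ 4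
        + invariant c * (2 * inner1 c ^ 2 * inner2 c)) / inner1 c)"
      using 3 nz by (intro rules invariant) auto
    with 3 show ?thesis unfolding solved_def[abs_def] Let_def by simp
  next
    case 4
    have "explicit_in ?V ?D (\<lambda>c. 3 * inner1 c ^ 2 * inner2 c
        + invariant c * (2 * inner1 c + inner2 c ^ 2))"
      using 4 by (intro rules invariant) auto
    with 4 show ?thesis unfolding solved_def[abs_def] Let_def by simp
  next
    case 5
    have "explicit_in ?V ?D (\<lambda>c. 3 * inner1 c * (inner1 c + inner2 c ^ 2)
        + invariant c * (2 * inner2 c))"
      using 5 by (intro rules invariant) auto
    with 5 show ?thesis unfolding solved_def[abs_def] Let_def by simp
  next
    case 6
    show ?thesis
    proof (cases "4 \<in> L")
      case True
      have "explicit_in ?V ?D (\<lambda>c. inner2 c * (6 * inner1 c + inner2 c ^ 2) +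
          (c 5 - 3 * inner1 c * (inner1 c + inner2 c ^ 2)) / (2 * inner2 c))"
        using 6 nz by (intro rules) auto
      with True 6 show ?thesis unfolding solved_def[abs_def] Let_def by simp
    next
      case False
      have "explicit_in ?V ?D (\<lambda>c. inner2 c * (6 * inner1 c + inner2 c ^ 2) +
          (c 4 - 3 * inner1 c ^ 2 * inner2 c) / (2 * inner1 c + inner2 c ^ 2))"
        using 6 nz by (intro rules) auto
      with False 6 show ?thesis unfolding solved_def[abs_def] Let_def by simp
    qed
  qed
qed

lemma solved_iff:
  assumes "constraint_denominators_nonzero c"
  defines "p \<equiv> inner1 c" and "q \<equiv> inner2 c" and "S \<equiv> invariant c"
  shows "2 \<in> L \<Longrightarrow> c 1 = solved L 1 c \<longleftrightarrow> c 3 * p - c 1 - p^4 = S * (2 * p^2 * q)"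
    and "2 \<notin> L \<Longrightarrow> c 1 = solved L 1 c \<longleftrightarrow> c 2 * p - c 1 * q = S * p^3"
    and "c 2 = solved L 2 c \<longleftrightarrow> c 2 * p - c 1 * q = S * p^3"
    and "c 3 = solved L 3 c \<longleftrightarrow> c 3 * p - c 1 - p^4 = S * (2 * p^2 * q)"
    and "c 4 = solved L 4 c \<longleftrightarrow> c 4 - 3 * p^2 * q = S * (2 * p + q^2)"
    and "c 5 = solved L 5 c \<longleftrightarrow> c 5 - 3 * p * (p + q^2) = S * (2 * q)"
    and "4 \<in> L \<Longrightarrow> c 6 = solved L 6 c \<longleftrightarrow> c 5 - 3 * p * (p + q^2) = S * (2 * q)"
    and "4 \<notin> L \<Longrightarrow> c 6 = solved L 6 c \<longleftrightarrow> c 4 - 3 * p^2 * q = S * (2 * p + q^2)"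
proof -
  note nz = constraint_denominators_inner[OF assms(1), folded p_def q_def]
  note defs = solved_def Let_def p_def[symmetric] q_def[symmetric] S_def[symmetric]
  have S: "S = c 6 - q * (6 * p + q^2)"
    unfolding S_def invariant_def p_def q_def ..
  have c6: "c 6 = q * (6 * p + q^2) + n / d \<longleftrightarrow> n = S * d" if "d \<noteq> 0" for n d
  proof -
    have "c 6 = q * (6 * p + q^2) + n / d \<longleftrightarrow> S = n / d"
      unfolding S by (metis add.commute add_diff_cancel_left' diff_add_cancel)
    also have "\<dots> \<longleftrightarrow> n = S * d" using that by (auto simp: nonzero_eq_divide_eq)
    finally show ?thesis .
  qed
  show "c 1 = solved L 1 c \<longleftrightarrow> c 3 * p - c 1 - p^4 = S * (2 * p^2 * q)" if "2 \<in> L"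
    using that by (auto simp: defs algebra_simps)
  show "c 1 = solved L 1 c \<longleftrightarrow> c 2 * p - c 1 * q = S * p^3" if "2 \<notin> L"
    using that nz(2) by (auto simp: defs nonzero_eq_divide_eq algebra_simps)
  show "c 2 = solved L 2 c \<longleftrightarrow> c 2 * p - c 1 * q = S * p^3"
    using nz(1) by (auto simp: defs nonzero_eq_divide_eq algebra_simps)
  show "c 3 = solved L 3 c \<longleftrightarrow> c 3 * p - c 1 - p^4 = S * (2 * p^2 * q)"
    using nz(1) by (auto simp: defs nonzero_eq_divide_eq algebra_simps)
  show "c 4 = solved L 4 c \<longleftrightarrow> c 4 - 3 * p^2 * q = S * (2 * p + q^2)"
    by (auto simp: defs algebra_simps)
  show "c 5 = solved L 5 c \<longleftrightarrow> c 5 - 3 * p * (p + q^2) = S * (2 * q)"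
    by (auto simp: defs algebra_simps)
  show "c 6 = solved L 6 c \<longleftrightarrow> c 5 - 3 * p * (p + q^2) = S * (2 * q)" if "4 \<in> L"
    using that c6[of "2 * q"] nz(2) by (simp add: defs)
  show "c 6 = solved L 6 c \<longleftrightarrow> c 4 - 3 * p^2 * q = S * (2 * p + q^2)" if "4 \<notin> L"
    using that c6[of "2 * p + q^2"] nz(3) by (simp add: defs)
qed

lemma constraints_iff_solved:
  assumes "L \<subseteq> {1..6}" "card L = 5" "constraint_denominators_nonzero c"
  shows "constraints c \<longleftrightarrow> (\<forall>l\<in>L. c l = solved L l c)"
proof -
  have "card ({1..6} - L) = 1"
    using assms(1,2) by (subst card_Diff_subset) (auto intro: finite_subset)
  then obtain k where k: "{1..6} - L = {k}" by (auto simp: card_1_singleton_iff)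
  then have "k \<in> {1..6}" by blast
  then consider "k = 1" | "k = 2" | "k = 3" | "k = 4" | "k = 5" | "k = 6" by fastforce
  moreover have L: "L = {1,2,3,4,5,6} - {k}"
    using assms(1) k by fastforce
  ultimately have cases: "L = {2,3,4,5,6} \<or> L = {1,3,4,5,6} \<or> L = {1,2,4,5,6}
    \<or> L = {1,2,3,5,6} \<or> L = {1,2,3,4,6} \<or> L = {1,2,3,4,5}"
    by cases (simp_all add: insert_Diff_if)
  define p q S where "p = inner1 c" and "q = inner2 c" and "S = invariant c"
  define E2 E3 E4 E5 where
    "E2 \<longleftrightarrow> c 2 * p - c 1 * q = S * p^3" and
    "E3 \<longleftrightarrow> c 3 * p - c 1 - p^4 = S * (2 * p^2 * q)" and
    "E4 \<longleftrightarrow> c 4 - 3 * p^2 * q = S * (2 * p + q^2)" and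
    "E5 \<longleftrightarrow> c 5 - 3 * p * (p + q^2) = S * (2 * q)"
  note eqs = p_def[symmetric] q_def[symmetric] S_def[symmetric]
    E2_def[symmetric] E3_def[symmetric] E4_def[symmetric] E5_def[symmetric]
  have "constraints c \<longleftrightarrow> E5 \<and> E4 \<and> E2 \<and> E3"
    using constraints_iff_four_equations[OF assms(3)] unfolding eqs .
  moreover note solved_iff[OF assms(3), of L, unfolded eqs]
  ultimately show ?thesis
    using cases by (elim disjE) (auto simp del: One_nat_def)
qed

lemma explicit_constraints:
  assumes "L \<subseteq> {1..6} \<and> card L = 5"
  shows "\<exists>F :: nat \<Rightarrow> rexp. (\<forall>l\<in>L. rexp_coeffs (F l) \<subseteq> {1..8} - {l}) \<and>
    (\<forall>c. constraint_denominators_nonzero c \<longrightarrow>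
      (\<forall>l\<in>L. rexp_defined c (F l)) \<and> (constraints c \<longleftrightarrow> (\<forall>l\<in>L. c l = rexp_val c (F l))))"
proof -
  have "explicit_in ({1..8} - {l}) constraint_denominators_nonzero (solved L l)" if "l \<in> L" for l
    using explicit_solved assms that by blast
  then obtain F where F: "\<forall>l\<in>L. rexp_coeffs (F l) \<subseteq> {1..8} - {l} \<and>
      (\<forall>c. constraint_denominators_nonzero c \<longrightarrow>
        rexp_defined c (F l) \<and> rexp_val c (F l) = solved L l c)"
    using explicit_family[of L "\<lambda>l. {1..8} - {l}" constraint_denominators_nonzero "solved L"] by blast
  have "constraints c \<longleftrightarrow> (\<forall>l\<in>L. c l = rexp_val c (F l))"
    if "constraint_denominators_nonzero c" for c
    using F that constraints_iff_solved[OF conjunct1[OF assms] conjunct2[OF assms] that] by simp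
  with F show ?thesis by (intro exI[of _ F]) blast
qed

theorem mainTheorem4:
  shows
    "(\<forall>P \<alpha> \<beta>. monic_of_degree_9 P \<and> coeff_formulas (coeff P) \<alpha> \<beta> \<longrightarrow>
        inversion_formulas (coeff P) \<alpha> \<beta> \<and> constraints (coeff P))
     \<and>
     (\<exists>A B :: nat \<Rightarrow> rexp.
        (\<forall>i\<in>{0,1,2}. rexp_coeffs (A i) \<subseteq> {8,7,4,3,1,0} \<and> rexp_coeffs (B i) \<subseteq> {8,7,4,3,1,0}) \<and>
        (\<forall>P \<alpha> \<beta>. monic_of_degree_9 P \<and> inversion_denominators_nonzero \<alpha> \<and>
            inversion_formulas (coeff P) \<alpha> \<beta> \<longrightarrow>
          (let a = (\<lambda>i. rexp_val (coeff P) (A i)); b = (\<lambda>i. rexp_val (coeff P) (B i)) in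
            (\<forall>i\<in>{0,1,2}. rexp_defined (coeff P) (A i) \<and> rexp_defined (coeff P) (B i)) \<and>
            inversion_denominators_nonzero a \<and>
            inversion_formulas (coeff P) a b \<and>
            equal_up_to_translation \<alpha> \<beta> a b)))
     \<and>
     (\<forall>L. L \<subseteq> {1..6} \<and> card L = 5 \<longrightarrow>
        (\<exists>F :: nat \<Rightarrow> rexp.
           (\<forall>l\<in>L. rexp_coeffs (F l) \<subseteq> {1..8} - {l}) \<and>
           (\<forall>P. monic_of_degree_9 P \<and> constraint_denominators_nonzero (coeff P) \<longrightarrow>
              (\<forall>l\<in>L. rexp_defined (coeff P) (F l)) \<and>
              (constraints (coeff P) \<longleftrightarrow>
                 (\<forall>l\<in>L. coeff P l = rexp_val (coeff P) (F l))))))"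
proof (intro conjI allI impI, goal_cases)
  case (1 P \<alpha> \<beta>)
  then show ?case by (blast intro: coeff_formulas_imp_inversion_formulas)
next
  case (2 P \<alpha> \<beta>)
  then show ?case by (blast intro: coeff_formulas_imp_constraints)
next
  case 3
  from explicit_inversion show ?case
    by (elim exE conjE, intro exI conjI) (assumption, blast)
next
  case (4 L)
  from explicit_constraints[OF this] show ?case
    by (elim exE conjE, intro exI conjI) (assumption, blast)
qed

end
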